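(* Let $M$ be a compact Riemannian manifold with boundary. Then for any $p\ge1$, $$T_p(M)\,\lambda_p(M)\le\mathrm{vol}(M)^{p-1}.$$
   Context: $\mathrm{vol}(M)$ is the volume of $M$. The first Dirichlet eigenvalue of the $p$-Laplacian and the $p$-torsional rigidity are $$\lambda_p(M)=\inf_{u\in W_0^{1,p}(M)\setminus\{0\}}\frac{\int_M|\nabla u|^p\,dx}{\int_M|u|^p\,dx},\qquad T_p(M)=\sup_{u\in W_0^{1,p}(M)\setminus\{0\}}\frac{\left|\int_Mu\,dx\right|^p}{\int_M|\nabla u|^p\,dx}.$$ *)

theory Defs
  imports "HOL-Analysis.Analysis"
begin

section \<open>Smooth maps on subsets of Euclidean space\<close>

primrec Ck_on :: "nat \<Rightarrow> (real^'n) set \<Rightarrow> (real^'n \<Rightarrow> 'b::real_normed_vector) \<Rightarrow> bool" where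
  "Ck_on 0 V f \<longleftrightarrow> continuous_on V f"
| "Ck_on (Suc k) V f \<longleftrightarrow> (\<forall>x\<in>V. f differentiable (at x)) \<and>
     (\<forall>i. Ck_on k V (\<lambda>x. frechet_derivative f (at x) (axis i 1)))"

(* Used for open V only. *)
definition Cinf_on :: "(real^'n) set \<Rightarrow> (real^'n \<Rightarrow> 'b::real_normed_vector) \<Rightarrow> bool" where
  "Cinf_on V f \<longleftrightarrow> (\<forall>k. Ck_on k V f)"

(* On a set that need not be open: local smooth extensibility. *)
definition smooth_on :: "(real^'n) set \<Rightarrow> (real^'n \<Rightarrow> 'b::real_normed_vector) \<Rightarrow> bool" where
  "smooth_on S f \<longleftrightarrow>
     (\<forall>x\<in>S. \<exists>V F. open V \<and> x \<in> V \<and> Cinf_on V F \<and> (\<forall>y\<in>V \<inter> S. F y = f y))"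

section \<open>Riemannian manifolds with boundary\<close>

(* Which coordinate bounds the model half-space is immaterial, but it has to be the same for
   all charts. *)
definition half_space :: "(real^'n) set" where
  "half_space = {x. 0 \<le> x $ (SOME k. True)}"

(* A chart is a coordinate map together with its domain. *)
type_synonym ('a, 'n) chart = "'a set \<times> ('a \<Rightarrow> real^'n)"

abbreviation cdom :: "('a, 'n::finite) chart \<Rightarrow> 'a set" where
  "cdom c \<equiv> fst c"

abbreviation cmap :: "('a, 'n::finite) chart \<Rightarrow> 'a \<Rightarrow> real^'n" where
  "cmap c \<equiv> snd c"

abbreviation cinv :: "('a, 'n::finite) chart \<Rightarrow> real^'n \<Rightarrow> 'a" where
  "cinv c \<equiv> inv_into (cdom c) (cmap c)"

definition is_chart :: "'a topology \<Rightarrow> ('a, 'n::finite) chart \<Rightarrow> bool" where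
  "is_chart X c \<longleftrightarrow> openin X (cdom c) \<and>
     openin (top_of_set half_space) (cmap c ` cdom c) \<and>
     homeomorphic_map (subtopology X (cdom c)) (top_of_set (cmap c ` cdom c)) (cmap c)"

abbreviation transition :: "('a, 'n::finite) chart \<Rightarrow> ('a, 'n) chart \<Rightarrow> real^'n \<Rightarrow> real^'n" where
  "transition c c' \<equiv> (\<lambda>x. cmap c' (cinv c x))"

abbreviation overlap :: "('a, 'n::finite) chart \<Rightarrow> ('a, 'n) chart \<Rightarrow> (real^'n) set" where
  "overlap c c' \<equiv> cmap c ` (cdom c \<inter> cdom c')"

(* gmat M c p is the matrix (g_ij) of the metric at the point p in the chart c. *)
record ('a, 'n) riem =
  mtop :: "'a topology"
  atlas :: "('a, 'n) chart set"
  gmat :: "('a, 'n) chart \<Rightarrow> 'a \<Rightarrow> real^'n^'n"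

definition second_countable_space :: "'a topology \<Rightarrow> bool" where
  "second_countable_space X \<longleftrightarrow> (\<exists>B. countable B \<and> (\<forall>V\<in>B. openin X V) \<and>
     (\<forall>U x. openin X U \<and> x \<in> U \<longrightarrow> (\<exists>V\<in>B. x \<in> V \<and> V \<subseteq> U)))"

definition smooth_manifold_with_boundary :: "('a, 'n::finite) riem \<Rightarrow> bool" where
  "smooth_manifold_with_boundary M \<longleftrightarrow>
     Hausdorff_space (mtop M) \<and> second_countable_space (mtop M) \<and>
     (\<forall>c\<in>atlas M. is_chart (mtop M) c) \<and>
     (\<Union>c\<in>atlas M. cdom c) = topspace (mtop M) \<and>
     (\<forall>c\<in>atlas M. \<forall>c'\<in>atlas M. smooth_on (overlap c c') (transition c c'))"

(* The derivatives D of the transition maps are taken within the (relatively open) overlap in the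
   half-space, where they are unique also at boundary points. The last clause is the
   transformation law of a covariant 2-tensor. *)
definition riemannian_metric :: "('a, 'n::finite) riem \<Rightarrow> bool" where
  "riemannian_metric M \<longleftrightarrow>
     (\<forall>c\<in>atlas M.
        smooth_on (cmap c ` cdom c) (\<lambda>x. gmat M c (cinv c x)) \<and>
        (\<forall>p\<in>cdom c. transpose (gmat M c p) = gmat M c p \<and>
           (\<forall>v. v \<noteq> 0 \<longrightarrow> 0 < v \<bullet> (gmat M c p *v v)))) \<and>
     (\<forall>c\<in>atlas M. \<forall>c'\<in>atlas M. \<forall>p\<in>cdom c \<inter> cdom c'. \<forall>D.
        (transition c c' has_derivative D) (at (cmap c p) within overlap c c') \<longrightarrow>
        (\<forall>v w. v \<bullet> (gmat M c p *v w) = D v \<bullet> (gmat M c' p *v D w)))"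

definition compact_riemannian_manifold_with_boundary :: "('a, 'n::finite) riem \<Rightarrow> bool" where
  "compact_riemannian_manifold_with_boundary M \<longleftrightarrow>
     smooth_manifold_with_boundary M \<and> riemannian_metric M \<and> compact_space (mtop M)"

definition minterior :: "('a, 'n::finite) riem \<Rightarrow> 'a set" where
  "minterior M = {p. \<exists>c\<in>atlas M. p \<in> cdom c \<and> cmap c p \<in> interior half_space}"

(* The Borel measure given by sqrt (det g) dx in every chart. *)
definition riem_measure :: "('a, 'n::finite) riem \<Rightarrow> 'a measure" where
  "riem_measure M = (THE \<mu>.
     sets \<mu> = sets (sigma (topspace (mtop M)) {U. openin (mtop M) U}) \<and>
     (\<forall>c\<in>atlas M. \<forall>A\<in>sets \<mu>. A \<subseteq> cdom c \<longrightarrow>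
        emeasure \<mu> A =
          (\<integral>\<^sup>+x\<in>cmap c ` A. ennreal (sqrt (det (gmat M c (cinv c x)))) \<partial>lborel)))"

definition riem_vol :: "('a, 'n::finite) riem \<Rightarrow> ennreal" where
  "riem_vol M = emeasure (riem_measure M) (space (riem_measure M))"

section \<open>Vector fields and weak gradients\<close>

(* Classical description of tangent vectors: a tangent vector at p assigns to every chart around p
   its components, subject to the contravariant transformation law. The values at charts that do
   not contain p are irrelevant. *)
type_synonym ('a, 'n) tvec = "('a, 'n) chart \<Rightarrow> real^'n"

definition tangent_vector :: "('a, 'n::finite) riem \<Rightarrow> 'a \<Rightarrow> ('a, 'n) tvec \<Rightarrow> bool" where
  "tangent_vector M p \<xi> \<longleftrightarrow>
     (\<forall>c\<in>atlas M. \<forall>c'\<in>atlas M. p \<in> cdom c \<inter> cdom c' \<longrightarrow>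
        (\<forall>D. (transition c c' has_derivative D) (at (cmap c p) within overlap c c') \<longrightarrow>
           \<xi> c' = D (\<xi> c)))"

(* The choice of the chart around p does not matter for tangent vectors. *)
definition tnorm :: "('a, 'n::finite) riem \<Rightarrow> 'a \<Rightarrow> ('a, 'n) tvec \<Rightarrow> real" where
  "tnorm M p \<xi> = (let c = (SOME c. c \<in> atlas M \<and> p \<in> cdom c)
     in sqrt (\<xi> c \<bullet> (gmat M c p *v \<xi> c)))"

definition measurable_vector_field ::
  "('a, 'n::finite) riem \<Rightarrow> ('a \<Rightarrow> ('a, 'n) tvec) \<Rightarrow> bool" where
  "measurable_vector_field M X \<longleftrightarrow>
     (\<forall>p\<in>topspace (mtop M). tangent_vector M p (X p)) \<and>
     (\<forall>c\<in>atlas M. (\<lambda>p. X p c) \<in> borel_measurable (restrict_space (riem_measure M) (cdom c)))"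

definition locally_integrable_on :: "(real^'n) set \<Rightarrow> (real^'n \<Rightarrow> real) \<Rightarrow> bool" where
  "locally_integrable_on \<Omega> f \<longleftrightarrow> (\<forall>K. compact K \<and> K \<subseteq> \<Omega> \<longrightarrow> set_integrable lborel K f)"

(* h is the i-th distributional partial derivative of f on the open set \<Omega>. *)
definition weak_partial_on ::
  "(real^'n) set \<Rightarrow> 'n \<Rightarrow> (real^'n \<Rightarrow> real) \<Rightarrow> (real^'n \<Rightarrow> real) \<Rightarrow> bool" where
  "weak_partial_on \<Omega> i f h \<longleftrightarrow>
     locally_integrable_on \<Omega> f \<and> locally_integrable_on \<Omega> h \<and>
     (\<forall>\<eta>. Cinf_on UNIV \<eta> \<and> (\<exists>K. compact K \<and> K \<subseteq> \<Omega> \<and> (\<forall>x. x \<notin> K \<longrightarrow> \<eta> x = 0)) \<longrightarrow>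
        (LINT x:\<Omega>|lborel. f x * frechet_derivative \<eta> (at x) (axis i 1)) =
        - (LINT x:\<Omega>|lborel. h x * \<eta> x))"

(* In every chart the lowered components g_ij X^j are the weak partial derivatives of u. *)
definition has_weak_gradient ::
  "('a, 'n::finite) riem \<Rightarrow> ('a \<Rightarrow> real) \<Rightarrow> ('a \<Rightarrow> ('a, 'n) tvec) \<Rightarrow> bool" where
  "has_weak_gradient M u X \<longleftrightarrow> measurable_vector_field M X \<and>
     (\<forall>c\<in>atlas M. \<forall>i. weak_partial_on (cmap c ` cdom c \<inter> interior half_space) i
        (\<lambda>x. u (cinv c x)) (\<lambda>x. (gmat M c (cinv c x) *v X (cinv c x) c) $ i))"

(* Weak gradients are unique up to null sets, and only integrals of weak_grad are used below. *)
definition weak_grad ::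
  "('a, 'n::finite) riem \<Rightarrow> ('a \<Rightarrow> real) \<Rightarrow> 'a \<Rightarrow> ('a, 'n) tvec" where
  "weak_grad M u = (SOME X. has_weak_gradient M u X)"

section \<open>Sobolev spaces\<close>

definition int_pow :: "('a, 'n::finite) riem \<Rightarrow> real \<Rightarrow> ('a \<Rightarrow> real) \<Rightarrow> ennreal" where
  "int_pow M p u = (\<integral>\<^sup>+x. ennreal (\<bar>u x\<bar> powr p) \<partial>riem_measure M)"

definition energy :: "('a, 'n::finite) riem \<Rightarrow> real \<Rightarrow> ('a \<Rightarrow> real) \<Rightarrow> ennreal" where
  "energy M p u = (\<integral>\<^sup>+x. ennreal (tnorm M x (weak_grad M u x) powr p) \<partial>riem_measure M)"

definition sobolev :: "('a, 'n::finite) riem \<Rightarrow> real \<Rightarrow> ('a \<Rightarrow> real) set" where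
  "sobolev M p = {u. u \<in> borel_measurable (riem_measure M) \<and> int_pow M p u < \<infinity> \<and>
     (\<exists>X. has_weak_gradient M u X) \<and> energy M p u < \<infinity>}"

definition test_functions :: "('a, 'n::finite) riem \<Rightarrow> ('a \<Rightarrow> real) set" where
  "test_functions M = {\<phi>.
     (\<forall>c\<in>atlas M. smooth_on (cmap c ` cdom c) (\<lambda>x. \<phi> (cinv c x))) \<and>
     (\<exists>K. compactin (mtop M) K \<and> K \<subseteq> minterior M \<and>
        (\<forall>x\<in>topspace (mtop M) - K. \<phi> x = 0))}"

(* The closure of the test functions in the W^{1,p}-norm. *)
definition sobolev0 :: "('a, 'n::finite) riem \<Rightarrow> real \<Rightarrow> ('a \<Rightarrow> real) set" where
  "sobolev0 M p = {u \<in> sobolev M p. \<exists>\<phi>. (\<forall>n. \<phi> n \<in> test_functions M) \<and>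
     (\<lambda>n::nat. int_pow M p (\<lambda>x. \<phi> n x - u x) + energy M p (\<lambda>x. \<phi> n x - u x)) \<longlonglongrightarrow> 0}"

(* Removing the zero element means removing all functions that vanish almost everywhere. *)
definition sobolev0_nonzero :: "('a, 'n::finite) riem \<Rightarrow> real \<Rightarrow> ('a \<Rightarrow> real) set" where
  "sobolev0_nonzero M p = {u \<in> sobolev0 M p. \<not> (AE x in riem_measure M. u x = 0)}"

section \<open>Dirichlet eigenvalue and torsional rigidity\<close>

(* Both quantities are extended nonnegative reals, so the supremum is meaningful without knowing
   a Poincare inequality. In ennreal, a / 0 = \<infinity> for a > 0, 0 / 0 = 0 and 0 * \<infinity> = 0; this
   matters only if M has a component without boundary. *)
definition dirichlet_eigenvalue :: "('a, 'n::finite) riem \<Rightarrow> real \<Rightarrow> ennreal" where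
  "dirichlet_eigenvalue M p = (INF u\<in>sobolev0_nonzero M p. energy M p u / int_pow M p u)"

definition torsional_rigidity :: "('a, 'n::finite) riem \<Rightarrow> real \<Rightarrow> ennreal" where
  "torsional_rigidity M p = (SUP u\<in>sobolev0_nonzero M p.
     ennreal (\<bar>LINT x|riem_measure M. u x\<bar> powr p) / energy M p u)"

(* Powers with exponent a \<ge> 0, with x^0 = 1 as usual (for the real powr, 0 powr 0 = 0). *)
definition ennreal_powr :: "ennreal \<Rightarrow> real \<Rightarrow> ennreal" where
  "ennreal_powr x a =
     (if a = 0 then 1 else if x = \<infinity> then \<infinity> else ennreal (enn2real x powr a))"

end

theory Submission
  imports Defs
begin

text \<open>For a single \<open>u\<close>, the quotient in the definition of \<open>T\<^sub>p\<close> times the Rayleigh quotient that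
bounds \<open>\<lambda>\<^sub>p\<close> is \<open>\<bar>\<integral>u\<bar>\<^sup>p / \<integral>\<bar>u\<bar>\<^sup>p\<close>, because the energies cancel. Jensen's inequality bounds this by
the volume to the power \<open>p - 1\<close>.\<close>

text \<open>The graph of a convex power lies above its tangent at \<open>m\<close>. The convexity
  and the derivative are taken on the open half-line, so \<open>a = 0\<close> is computed
  directly.\<close>

lemma powr_ge_tangent:
  fixes a m p :: real
  assumes "0 \<le> a" "0 < m" "1 \<le> p"
  shows "m powr p + p * m powr (p - 1) * (a - m) \<le> a powr p"
proof (cases "a = 0")
  case True
  have "m powr (p - 1) * m = m powr p"
    using assms powr_mult_base[of m "p - 1"] by (simp add: mult.commute)
  then have "m powr p + p * m powr (p - 1) * (a - m) = (1 - p) * m powr p"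
    using True by (simp add: algebra_simps)
  also have "\<dots> \<le> 0"
    using assms by (simp add: mult_nonpos_nonneg)
  finally show ?thesis
    using True by simp
next
  case False
  have "((\<lambda>x. x powr p) has_real_derivative p * m powr (p - 1)) (at m within {0<..})"
    using assms by (auto intro!: derivative_eq_intros)
  then have "p * m powr (p - 1) * (a - m) \<le> a powr p - m powr p"
    using False assms
    by (intro convex_on_imp_above_tangent[OF powr_convex])
       (auto simp: interior_open)
  then show ?thesis
    by simp
qed

lemma abs_integral_powr_le:
  fixes u :: "'a \<Rightarrow> real"
  assumes meas: "u \<in> borel_measurable N" and p: "1 \<le> p"
  shows "ennreal (\<bar>LINT x|N. u x\<bar> powr p)
           \<le> (\<integral>\<^sup>+x. ennreal (\<bar>u x\<bar> powr p) \<partial>N) * ennreal_powr (emeasure N (space N)) (p - 1)"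
    (is "_ \<le> ?I * ennreal_powr ?V _")
proof (cases "(LINT x|N. u x) = 0")
  \<comment> \<open>Also covers non-integrable \<open>u\<close>, whose Bochner integral is 0 by
    convention.\<close>
  case True
  then show ?thesis by simp
next
  case nz: False
  then have int: "integrable N u"
    using not_integrable_integral_eq by blast
  define A where "A = (LINT x|N. \<bar>u x\<bar>)"
  have le_A: "\<bar>LINT x|N. u x\<bar> \<le> A"
    unfolding A_def by (rule integral_abs_bound)
  then have A: "0 < A"
    using nz by linarith
  \<comment> \<open>Since 0 * \<infinity> = 0 in \<open>ennreal\<close>, the right-hand side could
    vanish when one factor is infinite; positivity of \<open>?I\<close> and \<open>?V\<close>
    excludes this.\<close>
  have I: "?I \<noteq> 0"
  proof
    assume "?I = 0"
    then have "AE x in N. u x = 0"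
      using meas by (simp add: nn_integral_0_iff_AE)
    then have "(LINT x|N. u x) = 0"
      by (simp add: integral_eq_zero_AE)
    with nz show False ..
  qed
  have V: "?V \<noteq> 0"
  proof
    assume "?V = 0"
    then have "AE x in N. False"
      by (simp add: AE_iff_measurable[OF sets.top])
    then have "(LINT x|N. u x) = 0"
      by (intro integral_eq_zero_AE) (auto elim: eventually_mono)
    with nz show False ..
  qed
  have "ennreal (A powr p) \<le> ?I * ennreal_powr ?V (p - 1)"
  proof -
    consider "p = 1" | "p > 1" "?V = \<infinity>" | "p > 1" "?I = \<infinity>" "?V < \<infinity>"
      | "p > 1" "?I < \<infinity>" "?V < \<infinity>"
      using p by (metis infinity_ennreal_def less_eq_real_def top.not_eq_extremum)
    then show ?thesis
    proof cases
      \<comment> \<open>The convention x^0 = 1 makes the volume factor 1 here, even if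
        \<open>?V\<close> is infinite.\<close>
      case 1
      have "?I = ennreal A"
        using int 1 unfolding A_def by (simp add: nn_integral_eq_integral)
      then show ?thesis
        using 1 A by (simp add: ennreal_powr_def)
    next
      case 2
      then show ?thesis
        using I by (simp add: ennreal_powr_def ennreal_mult_top)
    next
      case 3
      then interpret finite_measure N
        by (intro finite_measureI) simp
      show ?thesis
        using 3 V by (simp add: ennreal_powr_def emeasure_eq_measure ennreal_top_mult)
    next
      case 4
      then interpret finite_measure N
        by (intro finite_measureI) simp
      define v where "v = measure N (space N)"
      have v: "0 < v"
        using V by (simp add: v_def emeasure_eq_measure zero_less_measure_iff)
      \<comment> \<open>The mean of \<bar>u\<bar>: for the tangent at \<open>m\<close>, the linear
        term integrates to 0, which yields Jensen's inequality.\<close>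
      define m where "m = A / v"
      have m: "0 < m" "m * v = A"
        using A v by (simp_all add: m_def)
      have intp: "integrable N (\<lambda>x. \<bar>u x\<bar> powr p)"
        using meas 4 by (intro integrableI_nonneg) auto
      have "m powr p * v = m powr p * v + p * m powr (p - 1) * (A - m * v)"
        using m by simp
      also have "\<dots> = (LINT x|N. m powr p + p * m powr (p - 1) * (\<bar>u x\<bar> - m))"
        using int by (simp add: A_def v_def algebra_simps)
      also have "\<dots> \<le> (LINT x|N. \<bar>u x\<bar> powr p)"
        using int intp m p by (intro integral_mono powr_ge_tangent) auto
      finally have jensen: "m powr p * v \<le> (LINT x|N. \<bar>u x\<bar> powr p)" .
      have "A powr p = m powr p * v powr p"
        using m v by (simp flip: m(2) add: powr_mult)
      also have "\<dots> = (m powr p * v) * v powr (p - 1)"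
        using v powr_mult_base[of v "p - 1"] by simp
      also have "\<dots> \<le> (LINT x|N. \<bar>u x\<bar> powr p) * v powr (p - 1)"
        using jensen by (intro mult_right_mono) auto
      finally show ?thesis
        using 4 intp
        by (simp add: ennreal_powr_def nn_integral_eq_integral emeasure_eq_measure v_def
            flip: ennreal_mult)
    qed
  qed
  moreover have "ennreal (\<bar>LINT x|N. u x\<bar> powr p) \<le> ennreal (A powr p)"
    using le_A p by (intro ennreal_leI powr_mono2) auto
  ultimately show ?thesis
    by (rule order_trans[rotated])
qed

text \<open>The function \<open>u\<close> is itself a competitor in the infimum, so its own Rayleigh
  quotient bounds the eigenvalue.\<close>

lemma torsion_quotient_times_eigenvalue_le:
  fixes M :: "('a, 'n::finite) riem"
  assumes u: "u \<in> sobolev0_nonzero M p" and p: "1 \<le> p"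
  shows "ennreal (\<bar>LINT x|riem_measure M. u x\<bar> powr p) / energy M p u * dirichlet_eigenvalue M p
           \<le> ennreal_powr (riem_vol M) (p - 1)"
    (is "?L / ?E * ?lam \<le> ?R")
proof -
  have meas: "u \<in> borel_measurable (riem_measure M)" and fin: "int_pow M p u < \<infinity>" "?E < \<infinity>"
    and nz: "\<not> (AE x in riem_measure M. u x = 0)"
    using u by (auto simp: sobolev0_nonzero_def sobolev0_def sobolev_def)
  have I: "int_pow M p u \<noteq> 0"
    using nz meas by (simp add: int_pow_def nn_integral_0_iff_AE)
  have lam: "?lam \<le> ?E / int_pow M p u"
    unfolding dirichlet_eigenvalue_def using u by (rule INF_lower)
  show ?thesis
  proof (cases "?E = 0")
    \<comment> \<open>The torsion quotient may be \<infinity> here, but the Rayleigh quotient of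
      \<open>u\<close> forces the eigenvalue to be 0, and \<infinity> * 0 = 0.\<close>
    case True
    then show ?thesis using lam by simp
  next
    case False
    have "?L / ?E * ?lam \<le> ?L / ?E * (?E / int_pow M p u)"
      using lam by (rule mult_left_mono) simp
    also have "\<dots> = ?L / ?E * ?E / int_pow M p u"
      by (rule ennreal_times_divide)
    \<comment> \<open>Cancelling requires an energy that is neither 0 nor \<infinity>; it is finite
      because \<open>u\<close> is in the Sobolev space.\<close>
    also have "?L / ?E * ?E = ?L"
      using False fin by (simp add: ennreal_divide_times)
    also have "?L / int_pow M p u \<le> ?R"
      using abs_integral_powr_le[OF meas p] I
      by (intro divide_le_posI_ennreal) (simp_all add: int_pow_def riem_vol_def zero_less_iff_neq_zero)
    finally show ?thesis .
  qed
qed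

theorem corollary5p22:
  fixes M :: "('a, 'n::finite) riem" and p :: real
  assumes "compact_riemannian_manifold_with_boundary M"
    and "1 \<le> p"
  shows "torsional_rigidity M p * dirichlet_eigenvalue M p \<le> ennreal_powr (riem_vol M) (p - 1)"
  \<comment> \<open>In \<open>ennreal\<close> a constant factor moves inside any supremum, so a
    bound for each single \<open>u\<close> suffices.\<close>
  unfolding torsional_rigidity_def SUP_mult_right_ennreal
  using assms(2) by (intro SUP_least torsion_quotient_times_eigenvalue_le)

end
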